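(* Let $\mu$ be the measure on $\mathbb T$ associated with the sequence $\mathbf a=(a_n)_{n\in\mathbb N}$, $|a_n|<1$, of Schur parameters, let $\rho_n=\sqrt{1-|a_n|^2}$, and let $w_1,\dots,w_N\in\mathbb T$, $N\ge1$. If $\{\mathrm{supp}\,\mu\}'\subset\{w_1,w_2,\dots,w_N\}$, then $$\lim_{n}\prod_{i=1}^N\rho_{n+i}=0,\qquad N\ge1,$$ $$\lim_n\Big(\overline a_na_{n+N}-P\Big)\prod_{i=1}^{N-1}\rho_{n+i}=0,\qquad N\ge2,$$ $$\lim_n\left(\sum_{j=1}^N\overline a_{n+j-1}a_{n+j}+S\right)\prod_{i=1}^{N-1}\rho_{n+i}=0,\qquad N\ge2,$$ $$\lim_n\left(\sum_{j=1}^{N-1}\overline a_{n+j-1}a_{n+j}+P\,a_n\overline a_{n+N-1}+S\right)\prod_{i=1}^{N-2}\rho_{n+i}=0,\qquad N\ge2,$$ where $P:=(-1)^Nw_1w_2\cdots w_N$ and $S:=w_1+w_2+\cdots+w_N$.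
   Context: $\mathbb T=\{z\in\mathbb C:|z|=1\}$, $\mathbb D=\{z:|z|<1\}$. "Measure" means Borel probability measure. $\{\cdot\}'$ denotes the derived set (set of accumulation points). For a measure $\mu$ on $\mathbb T$ with infinite support, let $\varphi_n$ be the orthonormal polynomials in $L^2_\mu$ with $\deg\varphi_n=n$ and positive leading coefficient. They satisfy $\varphi_0=1$, $\rho_n\varphi_n(z)=z\varphi_{n-1}(z)+a_n\varphi_{n-1}^*(z)$ for $n\ge1$, where $p^*(z)=z^n\overline p(z^{-1})$ for a polynomial $p$ of degree $n$ ($\overline p$ has the conjugate coefficients of $p$), $a_n\in\mathbb D$ and $\rho_n=\sqrt{1-|a_n|^2}$. The numbers $a_n$ are the Schur parameters of $\mu$; $\mu\mapsto(a_n)$ is a bijection between measures on $\mathbb T$ with infinite support and sequences in $\mathbb D$. Empty products equal $1$. *)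

theory Defs
  imports "HOL-Probability.Probability" "HOL-Computational_Algebra.Polynomial"
begin

definition circle_prob :: "complex measure \<Rightarrow> bool" where
  "circle_prob \<mu> \<longleftrightarrow>
     prob_space \<mu> \<and> sets \<mu> = sets (restrict_space borel (sphere (0::complex) 1))"

definition msupp :: "'a::topological_space measure \<Rightarrow> 'a set" where
  "msupp \<mu> = {z \<in> space \<mu>. \<forall>U. open U \<and> z \<in> U \<longrightarrow> emeasure \<mu> (U \<inter> space \<mu>) > 0}"

definition orthonormal_polys :: "complex measure \<Rightarrow> (nat \<Rightarrow> complex poly) \<Rightarrow> bool" where
  "orthonormal_polys \<mu> \<phi> \<longleftrightarrow>
     (\<forall>n. degree (\<phi> n) = n \<and> (\<exists>c>0. lead_coeff (\<phi> n) = complex_of_real c)) \<and>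
     (\<forall>m n. (LINT z|\<mu>. poly (\<phi> m) z * cnj (poly (\<phi> n) z)) = (if m = n then 1 else 0))"

text \<open>The reversed polynomial \<open>z ^ n * cnj (p (1 / cnj z))\<close>, where \<open>n\<close> is the exact degree of \<open>p\<close>.\<close>

definition rev_poly :: "complex poly \<Rightarrow> complex poly" where
  "rev_poly p = reflect_poly (map_poly cnj p)"

definition rho :: "complex \<Rightarrow> real" where
  "rho \<alpha> = sqrt (1 - (norm \<alpha>)\<^sup>2)"

text \<open>
  For a probability measure on the circle with infinite support, the orthonormal polynomials,
  and hence the parameters, are unique. The parameters are indexed from 1; the value \<open>a 0\<close> is
  unconstrained.
\<close>

definition schur_parameters :: "complex measure \<Rightarrow> (nat \<Rightarrow> complex) \<Rightarrow> bool" where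
  "schur_parameters \<mu> a \<longleftrightarrow>
     (\<exists>\<phi>. orthonormal_polys \<mu> \<phi> \<and>
        (\<forall>n\<ge>1. norm (a n) < 1 \<and>
           smult (complex_of_real (rho (a n))) (\<phi> n)
             = pCons 0 (\<phi> (n - 1)) + smult (a n) (rev_poly (\<phi> (n - 1)))))"

end

theory Submission
  imports Defs
begin

text \<open>
  The polynomial \<open>p z = \<Prod>i. (z - w i)\<close> vanishes on the derived set of the support, so away from its
  zeros \<open>\<mu>\<close> has only finitely many atoms. At each atom the values of the orthonormal polynomials tend
  to 0, hence \<open>p * \<phi> n\<close> tends to 0 in \<open>L\<^sup>2\<close>; in operator terms, multiplication by \<open>p\<close> is compact.
  Consequently its inner products with any sequence of unit vectors tend to 0. With the unit vectors
  \<open>\<phi> (n + N)\<close>, \<open>\<phi>\<^sup>* (n + N - 1)\<close>, \<open>\<phi> (n + N - 1)\<close> and \<open>z * \<phi> (n + N - 2)\<close> only the constant and the two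
  leading coefficients of \<open>p * \<phi> n\<close> contribute, and they give the four limits; the second one arises
  in the form \<open>(a (n + N) - P * a n) * \<Prod>i. rho (a (n + i))\<close>, and is corrected by means of the first.
\<close>

section \<open>Reversed polynomials on the circle and products of linear factors\<close>

definition poly_inner :: "complex measure \<Rightarrow> complex poly \<Rightarrow> complex poly \<Rightarrow> complex" where
  "poly_inner M f g = (LINT z|M. poly f z * cnj (poly g z))"

lemma coeff_rev_poly: "coeff (rev_poly p) n = (if n > degree p then 0 else cnj (coeff p (degree p - n)))"
  by (simp add: rev_poly_def coeff_reflect_poly degree_map_poly coeff_map_poly)

lemma degree_rev_poly_le: "degree (rev_poly p) \<le> degree p"
  by (rule degree_le) (simp add: coeff_rev_poly)

lemma circle_times_cnj: "z * cnj z = 1" "cnj z * z = 1" if "norm z = 1"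
  using that by (simp_all add: complex_norm_square[symmetric] mult.commute[of "cnj z"])

lemma poly_rev_poly_circle:
  assumes "norm z = 1"
  shows "poly (rev_poly p) z = z ^ degree p * cnj (poly p z)"
proof -
  have nz: "z \<noteq> 0" using assms by auto
  have "cnj (inverse z) = z"
    using circle_times_cnj(2)[OF assms] by (metis complex_cnj_cnj inverse_unique mult.commute)
  with nz show ?thesis
    by (simp add: rev_poly_def poly_reflect_poly_nz degree_map_poly del: complex_cnj_inverse)
qed

text \<open>A factor \<open>z - w\<close> shifts the coefficients up by one and subtracts
  \<open>w\<close> times the old ones. So it keeps the top coefficient, lowers the next by
  \<open>w\<close> times the top one, and multiplies the constant term by \<open>- w\<close>. The
  degree bound is carried along because the induction step needs the coefficient above the top to
  vanish.\<close>

lemma prod_linear_mult_coeffs: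
  fixes f :: "complex poly"
  assumes "degree f \<le> Suc n"
  shows "degree ((\<Prod>i=1..N. [:- w i, 1:]) * f) \<le> Suc n + N \<and>
    coeff ((\<Prod>i=1..N. [:- w i, 1:]) * f) (Suc n + N) = coeff f (Suc n) \<and>
    coeff ((\<Prod>i=1..N. [:- w i, 1:]) * f) (n + N) = coeff f n - (\<Sum>i=1..N. w i) * coeff f (Suc n) \<and>
    coeff ((\<Prod>i=1..N. [:- w i, 1:]) * f) 0 = (-1) ^ N * (\<Prod>i=1..N. w i) * coeff f 0"
proof (induction N)
  case 0
  with assms show ?case by simp
next
  case (Suc N)
  let ?g = "(\<Prod>i=1..N. [:- w i, 1:]) * f"
  have eq: "(\<Prod>i=1..Suc N. [:- w i, 1:]) * f = smult (- w (Suc N)) ?g + pCons 0 ?g"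
    by (simp add: algebra_simps)
  have "degree (smult (- w (Suc N)) ?g + pCons 0 ?g) \<le> Suc n + Suc N"
    using Suc by (intro degree_add_le order_trans[OF degree_smult_le] order_trans[OF degree_pCons_le]) auto
  moreover have "coeff ?g (Suc (Suc (n + N))) = 0"
    using Suc by (intro coeff_eq_0) auto
  ultimately show ?case
    unfolding eq using Suc by (simp add: algebra_simps)
qed

text \<open>Three of the limits come out as negated inner products, through identities that start at
  index 1 because \<open>a 0\<close> is unconstrained.\<close>

lemma tendsto_0_eventually_minus:
  fixes f g :: "nat \<Rightarrow> complex"
  assumes "f \<longlonglongrightarrow> 0" and "\<And>n. n \<ge> 1 \<Longrightarrow> g n = - f n"
  shows "g \<longlonglongrightarrow> 0"
proof -
  have "(\<lambda>n. - f n) \<longlonglongrightarrow> 0"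
    using tendsto_minus[OF assms(1)] by simp
  then show ?thesis
    by (rule Lim_transform_eventually) (use assms(2) in \<open>auto simp: eventually_sequentially intro!: exI[of _ 1]\<close>)
qed

section \<open>Inner product, support and atoms of a measure on the circle\<close>

locale circle_measure = prob_space \<mu> for \<mu> :: "complex measure" +
  assumes sets_circle: "sets \<mu> = sets (restrict_space borel (sphere (0::complex) 1))"
begin

lemma space_circle: "space \<mu> = sphere 0 1"
  using sets_eq_imp_space_eq[OF sets_circle] by (simp add: space_restrict_space)

lemma measurable_continuous_on_circle:
  fixes h :: "complex \<Rightarrow> 'b::topological_space"
  assumes "continuous_on (sphere 0 1) h"
  shows "h \<in> borel_measurable \<mu>"
  using borel_measurable_continuous_on_restrict[OF assms]
  by (simp cong: measurable_cong_sets add: sets_circle)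

lemma integrable_continuous_on_circle:
  fixes h :: "complex \<Rightarrow> 'b::{banach, second_countable_topology}"
  assumes "continuous_on (sphere 0 1) h"
  shows "integrable \<mu> h"
proof -
  have "bounded (h ` sphere 0 1)"
    using assms by (intro compact_imp_bounded compact_continuous_image) auto
  then obtain B where "\<And>z. z \<in> sphere 0 1 \<Longrightarrow> norm (h z) \<le> B"
    unfolding bounded_iff by blast
  then show ?thesis
    by (intro integrable_const_bound[of _ B] measurable_continuous_on_circle assms AE_I2)
       (simp add: space_circle)
qed

lemma integrable_poly_inner: "integrable \<mu> (\<lambda>z. poly f z * cnj (poly g z))"
  by (intro integrable_continuous_on_circle continuous_intros)

lemma integrable_norm_poly: "integrable \<mu> (\<lambda>z. (norm (poly f z))\<^sup>2)"
  by (intro integrable_continuous_on_circle continuous_intros)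

abbreviation "ip \<equiv> poly_inner \<mu>"

lemma ip_add_left: "ip (f + g) h = ip f h + ip g h"
  unfolding poly_inner_def
  by (subst Bochner_Integration.integral_add[symmetric]) (simp_all add: integrable_poly_inner distrib_right)

lemma ip_smult_left: "ip (smult c f) g = c * ip f g"
  unfolding poly_inner_def
  by (subst integral_mult_right_zero[symmetric]) (simp add: mult.assoc)

lemma ip_cnj: "cnj (ip f g) = ip g f"
  unfolding poly_inner_def by (subst Bochner_Integration.integral_cnj[symmetric]) (simp add: mult.commute)

lemma ip_smult_right: "ip f (smult c g) = cnj c * ip f g"
  using arg_cong[OF ip_smult_left[of c g f], of cnj] by (simp add: ip_cnj)

lemma ip_diff_left: "ip (f - g) h = ip f h - ip g h"
  using ip_add_left[of f "smult (-1) g" h] ip_smult_left[of "-1" g h] by simp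

lemma ip_diff_right: "ip h (f - g) = ip h f - ip h g"
  using arg_cong[OF ip_diff_left[of f g h], of cnj] by (simp add: ip_cnj)

lemma ip_zero_left [simp]: "ip 0 g = 0"
  by (simp add: poly_inner_def)

lemma ip_sum_left: "ip (\<Sum>i\<in>A. f i) g = (\<Sum>i\<in>A. ip (f i) g)"
  by (induction A rule: infinite_finite_induct) (simp_all add: ip_add_left)

lemma ip_cong_circle:
  assumes "\<And>z. norm z = 1 \<Longrightarrow> poly f z * cnj (poly g z) = poly h z * cnj (poly k z)"
  shows "ip f g = ip h k"
  unfolding poly_inner_def
  by (rule Bochner_Integration.integral_cong) (use assms in \<open>auto simp: space_circle\<close>)

text \<open>Multiplication by \<open>z\<close> is an isometry, since \<open>z * cnj z = 1\<close> on
  the circle.\<close>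

lemma ip_pCons_pCons: "ip (pCons 0 f) (pCons 0 g) = ip f g"
proof (rule ip_cong_circle)
  fix z :: complex assume "norm z = 1"
  have "poly (pCons 0 f) z * cnj (poly (pCons 0 g) z) = (z * cnj z) * (poly f z * cnj (poly g z))"
    by simp
  then show "poly (pCons 0 f) z * cnj (poly (pCons 0 g) z) = poly f z * cnj (poly g z)"
    by (simp only: circle_times_cnj[OF \<open>norm z = 1\<close>] mult_1)
qed

lemma ip_self: "ip f f = complex_of_real (LINT z|\<mu>. (norm (poly f z))\<^sup>2)"
  unfolding poly_inner_def complex_norm_square[symmetric]
  by (rule integral_of_real[OF integrable_norm_poly])

text \<open>Bessel's inequality for a single unit vector: \<open>?g\<close> is \<open>f\<close>
  minus its projection onto \<open>h\<close>, and its squared norm is nonnegative.\<close>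

lemma norm_ip_le:
  assumes "ip h h = 1"
  shows "(norm (ip f h))\<^sup>2 \<le> (LINT z|\<mu>. (norm (poly f z))\<^sup>2)"
proof -
  let ?c = "ip f h"
  let ?g = "f - smult ?c h"
  have "ip ?g ?g = ip f f - ?c * cnj ?c"
    using assms ip_cnj[of f h] by (simp add: ip_diff_left ip_diff_right ip_smult_left ip_smult_right)
  then have "(LINT z|\<mu>. (norm (poly ?g z))\<^sup>2) = (LINT z|\<mu>. (norm (poly f z))\<^sup>2) - (norm ?c)\<^sup>2"
    unfolding ip_self complex_norm_square[symmetric] of_real_diff[symmetric] of_real_eq_iff .
  moreover have "(LINT z|\<mu>. (norm (poly ?g z))\<^sup>2) \<ge> 0"
    by simp
  ultimately show ?thesis by simp
qed

text \<open>Every point off the support has an open neighbourhood of measure 0. By Lindelof,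
  countably many of these neighbourhoods have the same union, which is therefore null.\<close>

lemma AE_msupp: "AE z in \<mu>. z \<in> msupp \<mu>"
proof -
  define F where "F = {U. open U \<and> emeasure \<mu> (U \<inter> space \<mu>) = 0}"
  obtain F' where F': "F' \<subseteq> F" "countable F'" "\<Union>F' = \<Union>F"
    using Lindelof[of F] unfolding F_def by blast
  have "(\<Union>U\<in>F'. U \<inter> space \<mu>) \<in> null_sets \<mu>"
  proof (intro null_sets_UN' F'(2) null_setsI)
    fix U assume "U \<in> F'"
    with F'(1) have U: "open U" "emeasure \<mu> (U \<inter> space \<mu>) = 0"
      by (auto simp: F_def)
    show "emeasure \<mu> (U \<inter> space \<mu>) = 0" by fact
    show "U \<inter> space \<mu> \<in> sets \<mu>"
      unfolding sets_circle using U(1) by (auto simp: space_circle sets_restrict_space)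
  qed
  then show ?thesis
  proof (rule AE_I')
    show "{z \<in> space \<mu>. z \<notin> msupp \<mu>} \<subseteq> (\<Union>U\<in>F'. U \<inter> space \<mu>)"
    proof
      fix z assume z: "z \<in> {z \<in> space \<mu>. z \<notin> msupp \<mu>}"
      then obtain U where "open U" "z \<in> U" "\<not> emeasure \<mu> (U \<inter> space \<mu>) > 0"
        by (auto simp: msupp_def)
      then have "z \<in> \<Union>F" by (auto simp: F_def)
      with F'(3) z show "z \<in> (\<Union>U\<in>F'. U \<inter> space \<mu>)" by blast
    qed
  qed
qed

text \<open>An infinite subset of the compact circle has a limit point, and closedness puts that
  point into \<open>K\<close>.\<close>

lemma finite_msupp_inter_closed:
  assumes "closed K" and "\<And>z. z \<in> K \<Longrightarrow> \<not> z islimpt msupp \<mu>"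
  shows "finite (msupp \<mu> \<inter> K)"
proof (rule ccontr)
  assume inf: "infinite (msupp \<mu> \<inter> K)"
  have "msupp \<mu> \<inter> K \<subseteq> sphere 0 1"
    by (auto simp: msupp_def space_circle)
  then obtain z where z: "z islimpt (msupp \<mu> \<inter> K)"
    using Heine_Borel_imp_Bolzano_Weierstrass[OF compact_sphere inf] by blast
  then have "z islimpt msupp \<mu>" and "z islimpt K"
    by (auto elim: islimpt_subset)
  with assms show False
    by (auto simp: closed_limpt)
qed

lemma singleton_in_sets: "norm z = 1 \<Longrightarrow> {z} \<in> sets \<mu>"
  unfolding sets_circle by (auto simp: sets_restrict_space image_iff intro!: bexI[of _ "{z}"])

lemma measure_singleton_le:
  assumes z: "norm z = 1"
  shows "measure \<mu> {z} * (norm (poly f z))\<^sup>2 \<le> (LINT x|\<mu>. (norm (poly f x))\<^sup>2)"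
proof -
  have "measure \<mu> {z} * (norm (poly f z))\<^sup>2 = (LINT x|\<mu>. indicator {z} x * (norm (poly f z))\<^sup>2)"
    using singleton_in_sets[OF z] by simp
  also have "\<dots> \<le> (LINT x|\<mu>. (norm (poly f x))\<^sup>2)"
  proof (rule integral_mono)
    show "integrable \<mu> (\<lambda>x. indicator {z} x * (norm (poly f z))\<^sup>2 :: real)"
      using singleton_in_sets[OF z] by (intro integrable_mult_left integrable_real_indicator) (auto simp: emeasure_eq_measure)
    show "integrable \<mu> (\<lambda>x. (norm (poly f x))\<^sup>2)"
      by (rule integrable_norm_poly)
  qed (auto simp: indicator_def)
  finally show ?thesis .
qed

end

section \<open>Orthonormal polynomials as test vectors\<close>

locale schur_system = circle_measure +
  fixes \<phi> :: "nat \<Rightarrow> complex poly" and a :: "nat \<Rightarrow> complex"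
  assumes orthonormal: "orthonormal_polys \<mu> \<phi>"
    and norm_schur: "n \<ge> 1 \<Longrightarrow> norm (a n) < 1"
    and szego: "n \<ge> 1 \<Longrightarrow> smult (complex_of_real (rho (a n))) (\<phi> n)
             = pCons 0 (\<phi> (n - 1)) + smult (a n) (rev_poly (\<phi> (n - 1)))"
begin

text \<open>The leading coefficient is a positive real of complex type; \<open>Re\<close> yields it
  as a real, so that ratios can be compared with products of \<open>rho\<close>.\<close>

definition kappa :: "nat \<Rightarrow> real" where
  "kappa n = Re (lead_coeff (\<phi> n))"

lemma degree_phi [simp]: "degree (\<phi> n) = n"
  using orthonormal by (simp add: orthonormal_polys_def)

lemma ip_phi_phi: "ip (\<phi> m) (\<phi> n) = (if m = n then 1 else 0)"
  using orthonormal by (simp add: orthonormal_polys_def poly_inner_def)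

lemma integral_norm_phi: "(LINT z|\<mu>. (norm (poly (\<phi> n) z))\<^sup>2) = 1"
  using ip_phi_phi[of n n] by (simp add: ip_self)

text \<open>
  Testing the atom at \<open>z\<close> against the reproducing kernel \<open>Q\<close> at \<open>z\<close>, which satisfies
  \<open>ip Q Q = Q z\<close>, bounds the partial sums of \<open>\<bar>\<phi> k z\<bar>\<^sup>2\<close> by the inverse of the mass.
\<close>

lemma measure_singleton_phi_tendsto_0:
  assumes z: "norm z = 1"
  shows "(\<lambda>n. measure \<mu> {z} * (norm (poly (\<phi> n) z))\<^sup>2) \<longlonglongrightarrow> 0"
proof -
  define m where "m = measure \<mu> {z}"
  have "(\<Sum>k<n. m * (norm (poly (\<phi> k) z))\<^sup>2) \<le> 1" for n
  proof -
    define q where "q = (\<Sum>k<n. (norm (poly (\<phi> k) z))\<^sup>2)"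
    define Q where "Q = (\<Sum>k<n. smult (cnj (poly (\<phi> k) z)) (\<phi> k))"
    have q: "q \<ge> 0" unfolding q_def by (intro sum_nonneg) auto
    have Qz: "poly Q z = q"
      unfolding Q_def q_def poly_sum of_real_sum complex_norm_square
      by (intro sum.cong) (simp_all add: mult.commute)
    have "ip (\<phi> k) Q = poly (\<phi> k) z" if "k < n" for k
    proof -
      have "ip Q (\<phi> k) = (\<Sum>j<n. if j = k then cnj (poly (\<phi> k) z) else 0)"
        unfolding Q_def ip_sum_left by (intro sum.cong) (auto simp: ip_smult_left ip_phi_phi)
      also have "\<dots> = cnj (poly (\<phi> k) z)" using that by simp
      finally show ?thesis
        by (metis complex_cnj_cnj ip_cnj)
    qed
    then have "ip Q Q = (\<Sum>k<n. cnj (poly (\<phi> k) z) * poly (\<phi> k) z)"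
      by (subst (1) Q_def) (simp add: ip_sum_left ip_smult_left)
    also have "\<dots> = q"
      unfolding q_def of_real_sum complex_norm_square by (intro sum.cong) (simp_all add: mult.commute)
    finally have "(LINT x|\<mu>. (norm (poly Q x))\<^sup>2) = q"
      unfolding ip_self of_real_eq_iff .
    with measure_singleton_le[OF z, of Q] have "m * q * q \<le> 1 * q"
      by (simp add: Qz m_def power2_eq_square mult.assoc)
    then have "m * q \<le> 1"
      using q by (cases "q = 0") (auto simp: mult_le_cancel_right)
    then show ?thesis by (simp add: q_def sum_distrib_left)
  qed
  then have "summable (\<lambda>n. m * (norm (poly (\<phi> n) z))\<^sup>2)"
    by (intro summableI_nonneg_bounded[of _ 1]) (auto simp: m_def)
  then show ?thesis
    unfolding m_def by (rule summable_LIMSEQ_zero)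
qed

lemma coeff_phi_lead: "coeff (\<phi> n) n = kappa n" and kappa_pos: "kappa n > 0"
proof -
  obtain c where "c > 0" "lead_coeff (\<phi> n) = complex_of_real c"
    using orthonormal unfolding orthonormal_polys_def by blast
  then show "coeff (\<phi> n) n = kappa n" "kappa n > 0"
    by (simp_all add: kappa_def)
qed

lemma kappa_nonzero [simp]: "kappa n \<noteq> 0"
  using kappa_pos[of n] by simp

lemma rho_pos: "n \<ge> 1 \<Longrightarrow> rho (a n) > 0"
  using norm_schur[of n] by (simp add: rho_def power_less_one_iff abs_square_less_1)

text \<open>Cancelling the leading term of \<open>f\<close> by a multiple of
  \<open>\<phi> (degree f)\<close>, which is orthogonal to \<open>\<phi> n\<close>, leaves the inner
  product unchanged and lowers the degree.\<close>

lemma ip_phi_degree_less: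
  assumes "degree f < n"
  shows "ip f (\<phi> n) = 0"
  using assms
proof (induction "degree f" arbitrary: f rule: less_induct)
  case less
  let ?c = "lead_coeff f / kappa (degree f)"
  let ?g = "f - smult ?c (\<phi> (degree f))"
  have g: "ip ?g (\<phi> n) = ip f (\<phi> n)"
    using less.prems by (simp add: ip_diff_left ip_smult_left ip_phi_phi)
  have "degree ?g \<le> degree f"
    by (intro degree_diff_le order_trans[OF degree_smult_le]) auto
  moreover have "coeff ?g (degree f) = 0"
    by (simp add: coeff_phi_lead)
  \<comment> \<open>A constant \<open>f\<close> leaves the zero polynomial, whose degree is no
    smaller; hence the separate case.\<close>
  ultimately have "?g = 0 \<or> degree ?g < degree f"
    by (metis leading_coeff_0_iff le_neq_implies_less)
  then have "ip ?g (\<phi> n) = 0"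
    using less by fastforce
  with g show ?case by simp
qed

lemma ip_phi:
  assumes "degree f \<le> n"
  shows "ip f (\<phi> n) = coeff f n / kappa n"
proof -
  let ?c = "coeff f n / kappa n"
  let ?g = "f - smult ?c (\<phi> n)"
  have g: "ip ?g (\<phi> n) = ip f (\<phi> n) - ?c"
    by (simp add: ip_diff_left ip_smult_left ip_phi_phi)
  have "degree ?g \<le> n"
    using assms by (intro degree_diff_le order_trans[OF degree_smult_le]) auto
  moreover have "coeff ?g n = 0"
    by (simp add: coeff_phi_lead)
  ultimately have "?g = 0 \<or> degree ?g < n"
    by (metis leading_coeff_0_iff le_neq_implies_less)
  then have "ip ?g (\<phi> n) = 0"
    using ip_phi_degree_less by fastforce
  with g show ?thesis by simp
qed

text \<open>Up to the factor \<open>kappa n\<close>, the reversed polynomial is the reproducing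
  kernel at 0. On the circle, pairing \<open>z ^ i\<close> with it amounts to pairing
  \<open>\<phi> n\<close> with \<open>z ^ (n - i)\<close>, which has degree below \<open>n\<close>
  unless \<open>i = 0\<close>.\<close>

lemma ip_rev_phi:
  assumes "degree f \<le> n"
  shows "ip f (rev_poly (\<phi> n)) = coeff f 0 / kappa n"
proof -
  have mon: "ip (monom c i) (rev_poly (\<phi> n)) = (if i = 0 then c / kappa n else 0)" if "i \<le> n" for i c
  proof -
    have "ip (monom c i) (rev_poly (\<phi> n)) = ip (\<phi> n) (monom (cnj c) (n - i))"
    proof (rule ip_cong_circle)
      fix z :: complex assume z: "norm z = 1"
      have "z ^ i * cnj z ^ n = z ^ i * (cnj z ^ i * cnj z ^ (n - i))"
        using that by (simp flip: power_add)
      also have "\<dots> = (z * cnj z) ^ i * cnj z ^ (n - i)"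
        by (simp add: power_mult_distrib)
      finally have "z ^ i * cnj z ^ n = cnj z ^ (n - i)"
        by (simp add: circle_times_cnj[OF z])
      then show "poly (monom c i) z * cnj (poly (rev_poly (\<phi> n)) z) =
          poly (\<phi> n) z * cnj (poly (monom (cnj c) (n - i)) z)"
        by (simp add: poly_rev_poly_circle[OF z] poly_monom algebra_simps)
    qed
    also have "\<dots> = cnj (ip (monom (cnj c) (n - i)) (\<phi> n))"
      by (simp add: ip_cnj)
    also have "\<dots> = (if i = 0 then c / kappa n else 0)"
      using that by (subst ip_phi) (auto intro: order_trans[OF degree_monom_le])
    finally show ?thesis .
  qed
  have "ip f (rev_poly (\<phi> n)) = (\<Sum>i\<le>n. ip (monom (coeff f i) i) (rev_poly (\<phi> n)))"
    by (subst poly_as_sum_of_monoms'[OF assms, symmetric]) (simp add: ip_sum_left)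
  also have "\<dots> = (\<Sum>i\<le>n. if i = 0 then coeff f 0 / kappa n else 0)"
    by (intro sum.cong) (auto simp: mon)
  finally show ?thesis by simp
qed

section \<open>Coefficient identities from the Szego recurrence\<close>

lemma pCons_phi:
  "pCons 0 (\<phi> n) = smult (rho (a (Suc n))) (\<phi> (Suc n)) - smult (a (Suc n)) (rev_poly (\<phi> n))"
  using szego[of "Suc n"] by simp

lemma coeff_rev_phi_0: "coeff (rev_poly (\<phi> n)) 0 = kappa n"
  by (simp add: coeff_rev_poly coeff_phi_lead)

lemma degree_rev_phi_le: "degree (rev_poly (\<phi> n)) \<le> n"
  using degree_rev_poly_le[of "\<phi> n"] by simp

lemma kappa_Suc: "rho (a (Suc n)) * kappa (Suc n) = kappa n"
proof -
  have "coeff (pCons 0 (\<phi> n)) (Suc n) = coeff (smult (rho (a (Suc n))) (\<phi> (Suc n)) - smult (a (Suc n)) (rev_poly (\<phi> n))) (Suc n)"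
    by (simp only: pCons_phi)
  then show ?thesis
    by (simp add: coeff_phi_lead coeff_rev_poly flip: of_real_mult)
qed

text \<open>The ratio telescopes by \<open>kappa_Suc\<close>. This is the origin of the products of
  \<open>rho\<close> in all four limits.\<close>

lemma kappa_ratio: "kappa n / kappa (n + k) = (\<Prod>i=1..k. rho (a (n + i)))"
proof (induction k)
  case (Suc k)
  have "kappa n / kappa (n + Suc k) = kappa n / kappa (n + k) * (kappa (n + k) / kappa (n + Suc k))"
    by simp
  also have "kappa (n + k) / kappa (n + Suc k) = rho (a (n + Suc k))"
    using kappa_Suc[of "n + k"] by (simp add: field_simps)
  finally show ?case using Suc by simp
qed simp

lemma coeff_phi_0: "n \<ge> 1 \<Longrightarrow> coeff (\<phi> n) 0 = a n * kappa n"
proof -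
  assume n: "n \<ge> 1"
  then obtain m where m: "n = Suc m" by (cases n) auto
  have "coeff (pCons 0 (\<phi> m)) 0 = coeff (smult (rho (a (Suc m))) (\<phi> (Suc m)) - smult (a (Suc m)) (rev_poly (\<phi> m))) 0"
    by (simp only: pCons_phi)
  then have "rho (a n) * coeff (\<phi> n) 0 = a n * kappa m"
    by (simp add: coeff_rev_phi_0 m)
  also have "\<dots> = rho (a n) * (a n * kappa n)"
    by (simp add: m flip: kappa_Suc[of m])
  finally show ?thesis using rho_pos[OF n] by simp
qed

text \<open>This is the second leading coefficient of the monic orthogonal polynomial. At
  \<open>n = 0\<close> truncated subtraction makes it 1, so its recurrence starts at
  \<open>n = 1\<close>.\<close>

definition subleading :: "nat \<Rightarrow> complex" where
  "subleading n = coeff (\<phi> n) (n - 1) / kappa n"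

lemma subleading_Suc:
  assumes "n \<ge> 1"
  shows "subleading (Suc n) = subleading n + cnj (a n) * a (Suc n)"
proof -
  have "coeff (pCons 0 (\<phi> n)) n = coeff (smult (rho (a (Suc n))) (\<phi> (Suc n)) - smult (a (Suc n)) (rev_poly (\<phi> n))) n"
    by (simp only: pCons_phi)
  then have "coeff (\<phi> n) (n - 1) = rho (a (Suc n)) * coeff (\<phi> (Suc n)) n - a (Suc n) * (cnj (a n) * kappa n)"
    using assms by (cases n) (simp_all add: coeff_rev_poly coeff_phi_0)
  then show ?thesis
    using rho_pos[of "Suc n"] by (simp add: subleading_def field_simps flip: kappa_Suc[of n])
qed

text \<open>The sums of products of consecutive Schur parameters in the last two limits are
  increments of \<open>subleading\<close>.\<close>

lemma subleading_add:
  assumes "n \<ge> 1"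
  shows "subleading (n + k) = subleading n + (\<Sum>j=1..k. cnj (a (n + j - 1)) * a (n + j))"
  using assms by (induction k) (simp_all add: subleading_Suc)

section \<open>Inner products with test vectors of degree one less\<close>

lemma ip_pCons_phi_phi:
  assumes "m \<ge> 1"
  shows "ip (pCons 0 (\<phi> m)) (\<phi> m) = - cnj (a m) * a (Suc m)"
proof -
  have "ip (rev_poly (\<phi> m)) (\<phi> m) = cnj (a m)"
    using assms by (simp add: ip_phi degree_rev_phi_le coeff_rev_poly coeff_phi_0)
  then show ?thesis
    by (simp add: pCons_phi ip_diff_left ip_smult_left ip_phi_phi)
qed

text \<open>In the recurrence for \<open>z * \<phi> m\<close>, the term in
  \<open>\<phi> (Suc m)\<close> is orthogonal to the reversed polynomial, which itself is a unit
  vector.\<close>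

lemma ip_pCons_phi_rev_phi: "ip (pCons 0 (\<phi> m)) (rev_poly (\<phi> m)) = - a (Suc m)"
proof -
  have "ip (rev_poly (\<phi> m)) (\<phi> (Suc m)) = 0"
    using degree_rev_phi_le[of m] by (intro ip_phi_degree_less) simp
  then have "ip (\<phi> (Suc m)) (rev_poly (\<phi> m)) = 0"
    by (metis complex_cnj_zero ip_cnj)
  moreover have "ip (rev_poly (\<phi> m)) (rev_poly (\<phi> m)) = 1"
    by (simp add: ip_rev_phi degree_rev_phi_le coeff_rev_phi_0)
  ultimately show ?thesis
    by (simp add: pCons_phi ip_diff_left ip_smult_left)
qed

text \<open>\<open>ip_phi\<close> and \<open>ip_rev_phi\<close> allow degree at most
  \<open>m\<close>. An excess of one is removed by a multiple of \<open>z * \<phi> m\<close>, whose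
  leading coefficient is \<open>kappa m\<close> and whose inner products with the test vectors are
  known.\<close>

lemma degree_reduce_Suc:
  assumes "degree f \<le> Suc m"
  shows "degree (f - smult (coeff f (Suc m) / kappa m) (pCons 0 (\<phi> m))) \<le> m"
proof (rule degree_le, intro allI impI)
  fix i assume "m < i"
  then show "coeff (f - smult (coeff f (Suc m) / kappa m) (pCons 0 (\<phi> m))) i = 0"
    using assms by (cases "i = Suc m") (auto simp: coeff_phi_lead coeff_eq_0 coeff_pCons split: nat.split)
qed

text \<open>The term \<open>subleading m\<close> comes from the coefficient at \<open>z ^ m\<close>
  of the removed multiple, the other one from its inner product with \<open>\<phi> m\<close>. By
  \<open>subleading_Suc\<close> they add up to \<open>subleading (Suc m)\<close>.\<close>

lemma ip_phi_Suc:
  assumes "degree f \<le> Suc m" "m \<ge> 1"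
  shows "ip f (\<phi> m) = (coeff f m - coeff f (Suc m) * (cnj (a m) * a (Suc m) + subleading m)) / kappa m"
proof -
  let ?c = "coeff f (Suc m) / kappa m"
  let ?g = "f - smult ?c (pCons 0 (\<phi> m))"
  have "ip f (\<phi> m) = ip ?g (\<phi> m) + ?c * ip (pCons 0 (\<phi> m)) (\<phi> m)"
    by (simp only: ip_diff_left ip_smult_left) simp
  also have "ip ?g (\<phi> m) = coeff ?g m / kappa m"
    by (rule ip_phi[OF degree_reduce_Suc[OF assms(1)]])
  also have "coeff ?g m = coeff f m - coeff f (Suc m) * subleading m"
    using assms(2) by (cases m) (simp_all add: subleading_def)
  finally show ?thesis
    using assms(2) by (simp add: ip_pCons_phi_phi add_divide_distrib diff_divide_distrib algebra_simps)
qed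

lemma ip_rev_phi_Suc:
  assumes "degree f \<le> Suc m"
  shows "ip f (rev_poly (\<phi> m)) = (coeff f 0 - a (Suc m) * coeff f (Suc m)) / kappa m"
proof -
  let ?c = "coeff f (Suc m) / kappa m"
  let ?g = "f - smult ?c (pCons 0 (\<phi> m))"
  have "ip f (rev_poly (\<phi> m)) = ip ?g (rev_poly (\<phi> m)) + ?c * ip (pCons 0 (\<phi> m)) (rev_poly (\<phi> m))"
    by (simp only: ip_diff_left ip_smult_left) simp
  \<comment> \<open>The removed multiple vanishes at 0, so the constant term is still that of
    \<open>f\<close>.\<close>
  also have "ip ?g (rev_poly (\<phi> m)) = coeff f 0 / kappa m"
    by (subst ip_rev_phi[OF degree_reduce_Suc[OF assms]]) simp
  finally show ?thesis
    by (simp add: ip_pCons_phi_rev_phi diff_divide_distrib)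
qed

text \<open>With \<open>f = c + z * g\<close>, the isometry cancels \<open>z\<close> in the second
  part and reduces it to \<open>ip_phi_Suc\<close>; the constant \<open>c\<close> contributes the
  term with \<open>coeff f 0\<close>.\<close>

lemma ip_pCons_phi_Suc_Suc:
  assumes "degree f \<le> Suc (Suc m)" "m \<ge> 1"
  shows "ip f (pCons 0 (\<phi> m)) = (coeff f (Suc m)
    - coeff f (Suc (Suc m)) * (cnj (a m) * a (Suc m) + subleading m)
    - coeff f 0 * cnj (a (Suc m))) / kappa m"
proof -
  obtain c g where f: "f = pCons c g" by (rule pCons_cases)
  have g: "degree g \<le> Suc m" using assms(1) by (auto simp: f split: if_splits)
  have "ip f (pCons 0 (\<phi> m)) = c * ip 1 (pCons 0 (\<phi> m)) + ip g (\<phi> m)"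
  proof -
    have "f = smult c 1 + pCons 0 g" by (simp add: f)
    then show ?thesis by (simp only: ip_add_left ip_smult_left ip_pCons_pCons)
  qed
  also have "ip 1 (pCons 0 (\<phi> m)) = - cnj (a (Suc m)) / kappa m"
  proof -
    \<comment> \<open>Constants are orthogonal to \<open>\<phi> (Suc m)\<close>, so only the
      reversed polynomial in the recurrence contributes.\<close>
    have "ip 1 (pCons 0 (\<phi> m)) = - cnj (a (Suc m)) * ip 1 (rev_poly (\<phi> m))"
      using ip_phi_degree_less[of 1 "Suc m"]
      by (simp add: pCons_phi ip_diff_right ip_smult_right)
    then show ?thesis by (simp add: ip_rev_phi)
  qed
  also have "ip g (\<phi> m) = (coeff g m - coeff g (Suc m) * (cnj (a m) * a (Suc m) + subleading m)) / kappa m"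
    by (rule ip_phi_Suc[OF g assms(2)])
  finally show ?thesis by (simp add: f add_divide_distrib diff_divide_distrib algebra_simps)
qed

section \<open>Compactness of multiplication by a polynomial vanishing on the derived set\<close>

text \<open>
  Away from the zeros of \<open>g\<close> the measure consists of finitely many atoms, where \<open>\<phi> n\<close> loses its mass.
\<close>

lemma integral_norm_phi_weighted_tendsto_0:
  fixes g :: "complex \<Rightarrow> real"
  assumes g: "continuous_on (sphere 0 1) g" "\<And>z. g z \<ge> 0"
    and g0: "\<And>z. z islimpt msupp \<mu> \<Longrightarrow> g z = 0"
  shows "(\<lambda>n. LINT z|\<mu>. g z * (norm (poly (\<phi> n) z))\<^sup>2) \<longlonglongrightarrow> 0"
proof (rule LIMSEQ_I)
  fix r :: real assume "r > 0"
  \<comment> \<open>One half of \<open>r\<close> is spent where \<open>g\<close> is small, the other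
    on the atoms.\<close>
  define e where "e = r / 2"
  have e: "e > 0" using \<open>r > 0\<close> by (simp add: e_def)
  \<comment> \<open>\<open>g\<close> vanishes at the limit points of the support, so
    \<open>K\<close> contains none of them and meets the support in a finite set.\<close>
  define K where "K = {z \<in> sphere 0 1. e \<le> g z}"
  have "closed K"
    unfolding K_def by (intro continuous_on_closed_Collect_le continuous_on_const g closed_sphere)
  then have fin: "finite (msupp \<mu> \<inter> K)"
    using e g0 by (intro finite_msupp_inter_closed) (auto simp: K_def)
  define F where "F = msupp \<mu> \<inter> K"
  have Fn: "norm x = 1" if "x \<in> F" for x using that by (auto simp: F_def K_def)
  let ?R = "\<lambda>n. \<Sum>x\<in>F. g x * (measure \<mu> {x} * (norm (poly (\<phi> n) x))\<^sup>2)"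
  have bound: "(LINT z|\<mu>. g z * (norm (poly (\<phi> n) z))\<^sup>2) \<le> e + ?R n" for n
  proof -
    let ?f = "\<lambda>z. (norm (poly (\<phi> n) z))\<^sup>2"
    have int1: "integrable \<mu> (\<lambda>z. e * ?f z)"
      by (intro integrable_continuous_on_circle continuous_intros)
    have int2: "integrable \<mu> (\<lambda>z. indicator {x} z * (g x * ?f x) :: real)" if "x \<in> F" for x
      using singleton_in_sets[OF Fn[OF that]]
      by (intro integrable_mult_left integrable_real_indicator) (auto simp: emeasure_eq_measure)
    \<comment> \<open>For a support point outside \<open>F\<close>, \<open>g z\<close> is at most
      \<open>e\<close>; at a point of \<open>F\<close> the summand with \<open>x = z\<close> already
      equals the left-hand side.\<close>
    have "(LINT z|\<mu>. g z * ?f z) \<le> (LINT z|\<mu>. e * ?f z + (\<Sum>x\<in>F. indicator {x} z * (g x * ?f x)))"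
    proof (rule integral_mono_AE)
      show "integrable \<mu> (\<lambda>z. g z * ?f z)"
        by (intro integrable_continuous_on_circle continuous_intros g)
      show "integrable \<mu> (\<lambda>z. e * ?f z + (\<Sum>x\<in>F. indicator {x} z * (g x * ?f x)))"
        by (intro Bochner_Integration.integrable_add Bochner_Integration.integrable_sum int1 int2)
      show "AE z in \<mu>. g z * ?f z \<le> e * ?f z + (\<Sum>x\<in>F. indicator {x} z * (g x * ?f x))"
        using AE_msupp
      proof eventually_elim
        fix z assume z: "z \<in> msupp \<mu>"
        have nonneg: "(\<Sum>x\<in>F. indicator {x} z * (g x * ?f x)) \<ge> 0"
          using g(2) by (intro sum_nonneg) auto
        show "g z * ?f z \<le> e * ?f z + (\<Sum>x\<in>F. indicator {x} z * (g x * ?f x))"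
        proof (cases "z \<in> F")
          case True
          have "g z * ?f z = (\<Sum>x\<in>{z}. indicator {x} z * (g x * ?f x))" by simp
          also have "\<dots> \<le> (\<Sum>x\<in>F. indicator {x} z * (g x * ?f x))"
            using g(2) True fin by (intro sum_mono2) (auto simp: F_def)
          finally show ?thesis using e by (smt (verit) mult_nonneg_nonneg zero_le_power2)
        next
          case False
          with z have "g z \<le> e" by (auto simp: F_def K_def msupp_def space_circle)
          then have "g z * ?f z \<le> e * ?f z" by (intro mult_right_mono) auto
          with nonneg show ?thesis by simp
        qed
      qed
    qed
    also have "\<dots> = (LINT z|\<mu>. e * ?f z) + (LINT z|\<mu>. (\<Sum>x\<in>F. indicator {x} z * (g x * ?f x)))"
      by (intro Bochner_Integration.integral_add Bochner_Integration.integrable_sum int1 int2)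
    also have "(LINT z|\<mu>. (\<Sum>x\<in>F. indicator {x} z * (g x * ?f x)))
        = (\<Sum>x\<in>F. LINT z|\<mu>. indicator {x} z * (g x * ?f x))"
      by (intro Bochner_Integration.integral_sum int2)
    also have "(LINT z|\<mu>. e * ?f z) = e"
      by (simp add: integral_norm_phi)
    also have "(\<Sum>x\<in>F. LINT z|\<mu>. indicator {x} z * (g x * ?f x)) = ?R n"
      using singleton_in_sets[OF Fn] by (intro sum.cong) (auto simp: mult_ac)
    finally show ?thesis .
  qed
  have "?R \<longlonglongrightarrow> (\<Sum>x\<in>F. g x * 0)"
    by (intro tendsto_sum tendsto_mult tendsto_const measure_singleton_phi_tendsto_0 Fn)
  then have "eventually (\<lambda>n. ?R n < e) sequentially"
    using e by (intro order_tendstoD(2)) auto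
  then have "eventually (\<lambda>n. norm ((LINT z|\<mu>. g z * (norm (poly (\<phi> n) z))\<^sup>2) - 0) < r) sequentially"
  proof eventually_elim
    case (elim n)
    have "(LINT z|\<mu>. g z * (norm (poly (\<phi> n) z))\<^sup>2) \<ge> 0"
      using g(2) by (intro Bochner_Integration.integral_nonneg) auto
    with elim bound[of n] show ?case by (simp add: e_def)
  qed
  then show "\<exists>n0. \<forall>n\<ge>n0. norm ((LINT z|\<mu>. g z * (norm (poly (\<phi> n) z))\<^sup>2) - 0) < r"
    by (simp add: eventually_sequentially)
qed

text \<open>With the squared modulus of \<open>p\<close> as weight, \<open>p * \<phi> n\<close>
  tends to 0 in norm, and \<open>norm_ip_le\<close> bounds each inner product by that norm.\<close>

lemma ip_mult_phi_tendsto_0: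
  assumes p: "\<And>z. z islimpt msupp \<mu> \<Longrightarrow> poly p z = 0"
    and h: "\<And>n. ip (h n) (h n) = 1"
  shows "(\<lambda>n. ip (p * \<phi> n) (h n)) \<longlonglongrightarrow> 0"
proof -
  have "(\<lambda>n. LINT z|\<mu>. (norm (poly p z))\<^sup>2 * (norm (poly (\<phi> n) z))\<^sup>2) \<longlonglongrightarrow> 0"
    using p by (intro integral_norm_phi_weighted_tendsto_0 continuous_intros) auto
  then have "(\<lambda>n. LINT z|\<mu>. (norm (poly (p * \<phi> n) z))\<^sup>2) \<longlonglongrightarrow> 0"
    by (simp add: norm_mult power_mult_distrib)
  then have "(\<lambda>n. (norm (ip (p * \<phi> n) (h n)))\<^sup>2) \<longlonglongrightarrow> 0"
    by (rule tendsto_sandwich[rotated 3, where f = "\<lambda>_. 0"])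
       (intro always_eventually allI norm_ip_le h zero_le_power2 tendsto_const)+
  then have "(\<lambda>n. sqrt ((norm (ip (p * \<phi> n) (h n)))\<^sup>2)) \<longlonglongrightarrow> sqrt 0"
    by (rule tendsto_real_sqrt)
  then show ?thesis by (simp add: tendsto_norm_zero_iff)
qed

section \<open>The four limits\<close>

context
  fixes w :: "nat \<Rightarrow> complex" and N :: nat
  assumes N: "N \<ge> 1"
    and derived: "\<And>z. z islimpt msupp \<mu> \<Longrightarrow> z \<in> w ` {1..N}"
begin

abbreviation "lin_prod \<equiv> (\<Prod>i=1..N. [:- w i, 1:])"

abbreviation "P \<equiv> (-1) ^ N * (\<Prod>i=1..N. w i)"

abbreviation "S \<equiv> (\<Sum>i=1..N. w i)"

lemma ip_lin_prod_tendsto_0: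
  assumes "\<And>n. ip (h n) (h n) = 1"
  shows "(\<lambda>n. ip (lin_prod * \<phi> n) (h n)) \<longlonglongrightarrow> 0"
proof (rule ip_mult_phi_tendsto_0[OF _ assms])
  fix z assume "z islimpt msupp \<mu>"
  from derived[OF this] show "poly lin_prod z = 0"
    by (auto simp: poly_prod)
qed

lemma lin_prod_phi_coeffs:
  assumes "n \<ge> 1"
  shows "degree (lin_prod * \<phi> n) \<le> n + N"
    and "coeff (lin_prod * \<phi> n) (n + N) = kappa n"
    and "coeff (lin_prod * \<phi> n) (n + N - 1) = kappa n * (subleading n - S)"
    and "coeff (lin_prod * \<phi> n) 0 = P * a n * kappa n"
proof -
  obtain k where n: "n = Suc k" using assms by (cases n) auto
  from prod_linear_mult_coeffs[of "\<phi> n" k w N] coeff_phi_0[OF assms]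
  show "degree (lin_prod * \<phi> n) \<le> n + N"
    and "coeff (lin_prod * \<phi> n) (n + N) = kappa n"
    and "coeff (lin_prod * \<phi> n) (n + N - 1) = kappa n * (subleading n - S)"
    and "coeff (lin_prod * \<phi> n) 0 = P * a n * kappa n"
    unfolding n by (simp_all add: subleading_def coeff_phi_lead algebra_simps)
qed

text \<open>Against \<open>\<phi> (n + N)\<close> only the leading coefficient
  \<open>kappa n\<close> counts, which gives \<open>kappa n / kappa (n + N)\<close>.\<close>

lemma rho_prod_tendsto_0: "(\<lambda>n. \<Prod>i=1..N. rho (a (n + i))) \<longlonglongrightarrow> 0"
proof -
  have "(\<lambda>n. ip (lin_prod * \<phi> n) (\<phi> (n + N))) \<longlonglongrightarrow> 0"
    by (rule ip_lin_prod_tendsto_0) (simp add: ip_phi_phi)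
  moreover have "eventually (\<lambda>n. ip (lin_prod * \<phi> n) (\<phi> (n + N)) =
      complex_of_real (\<Prod>i=1..N. rho (a (n + i)))) sequentially"
    using eventually_ge_at_top[of 1]
  proof eventually_elim
    case (elim n)
    then show ?case
      by (simp only: ip_phi lin_prod_phi_coeffs flip: kappa_ratio of_real_divide)
  qed
  ultimately have "(\<lambda>n. complex_of_real (\<Prod>i=1..N. rho (a (n + i)))) \<longlonglongrightarrow> of_real 0"
    by (simp add: tendsto_cong)
  then show ?thesis
    unfolding tendsto_of_real_iff .
qed

lemma schur_minus_P_tendsto_0:
  "(\<lambda>n. (a (n + N) - P * a n) * complex_of_real (\<Prod>i=1..N - 1. rho (a (n + i)))) \<longlonglongrightarrow> 0"
proof (rule tendsto_0_eventually_minus)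
  show "(\<lambda>n. ip (lin_prod * \<phi> n) (rev_poly (\<phi> (n + (N - 1))))) \<longlonglongrightarrow> 0"
    by (rule ip_lin_prod_tendsto_0) (simp add: ip_rev_phi degree_rev_phi_le coeff_rev_phi_0)
next
  fix n :: nat assume n: "n \<ge> 1"
  have eq: "n + N = Suc (n + (N - 1))" using N by simp
  note c = lin_prod_phi_coeffs(1,2,4)[OF n, unfolded eq]
  have ip: "ip (lin_prod * \<phi> n) (rev_poly (\<phi> (n + (N - 1))))
      = (P * a n * kappa n - a (n + N) * kappa n) / kappa (n + (N - 1))"
    unfolding eq ip_rev_phi_Suc[OF c(1)] c(2,3) ..
  show "(a (n + N) - P * a n) * complex_of_real (\<Prod>i=1..N - 1. rho (a (n + i)))
      = - ip (lin_prod * \<phi> n) (rev_poly (\<phi> (n + (N - 1))))"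
    unfolding ip kappa_ratio[symmetric] by (simp add: diff_divide_distrib algebra_simps)
qed

text \<open>Multiplying the previous limit by \<open>cnj (a n)\<close> produces
  \<open>P * a n * cnj (a n)\<close> where \<open>P\<close> is wanted. The discrepancy is
  \<open>P\<close> times the square of \<open>rho (a n)\<close>; one factor \<open>rho (a n)\<close>
  completes \<open>Q n\<close> to the full product \<open>R (n - 1)\<close>, which tends to 0, and
  the other is bounded.\<close>

lemma cnj_schur_minus_P_tendsto_0:
  "(\<lambda>n. (cnj (a n) * a (n + N) - P) * complex_of_real (\<Prod>i=1..N - 1. rho (a (n + i)))) \<longlonglongrightarrow> 0"
proof -
  define Q where "Q n = (\<Prod>i=1..N - 1. rho (a (n + i)))" for n
  define R where "R n = (\<Prod>i=1..N. rho (a (n + i)))" for n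
  have R: "(\<lambda>n. complex_of_real (R (n - 1))) \<longlonglongrightarrow> 0"
  proof -
    have "(\<lambda>n. R (Suc n - 1)) \<longlonglongrightarrow> 0"
      using rho_prod_tendsto_0 by (simp add: R_def)
    then have "(\<lambda>n. R (n - 1)) \<longlonglongrightarrow> 0"
      by (rule LIMSEQ_imp_Suc)
    then show ?thesis by (metis of_real_0 tendsto_of_real_iff)
  qed
  have bounded: "norm (cnj (a n)) \<le> 1" "norm (complex_of_real (rho (a n))) \<le> 1" if "n \<ge> 1" for n
    using norm_schur[OF that] rho_pos[OF that] by (auto simp: rho_def)
  have "(\<lambda>n. cnj (a n) * ((a (n + N) - P * a n) * Q n)) \<longlonglongrightarrow> 0"
    using schur_minus_P_tendsto_0[folded Q_def] bounded(1)
    by (intro Lim_null_comparison[OF _ tendsto_norm_zero[OF schur_minus_P_tendsto_0[folded Q_def]]])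
       (auto simp: eventually_sequentially norm_mult intro!: exI[of _ 1] mult_left_le_one_le)
  moreover have "(\<lambda>n. - P * (complex_of_real (rho (a n)) * complex_of_real (R (n - 1)))) \<longlonglongrightarrow> - P * 0"
    using bounded(2)
    by (intro tendsto_mult_left Lim_null_comparison[OF _ tendsto_norm_zero[OF R]])
       (auto simp: eventually_sequentially norm_mult abs_mult intro!: exI[of _ 1] mult_left_le_one_le)
  ultimately have "(\<lambda>n. cnj (a n) * ((a (n + N) - P * a n) * Q n) - P * (complex_of_real (rho (a n)) * complex_of_real (R (n - 1)))) \<longlonglongrightarrow> 0"
    by (auto dest: tendsto_add)
  moreover have "eventually (\<lambda>n. cnj (a n) * ((a (n + N) - P * a n) * Q n) - P * (complex_of_real (rho (a n)) * complex_of_real (R (n - 1)))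
      = (cnj (a n) * a (n + N) - P) * Q n) sequentially"
    using eventually_ge_at_top[of 1]
  proof eventually_elim
    case (elim n)
    have "R (n - 1) = rho (a n) * Q n"
    proof -
      \<comment> \<open>Since \<open>n\<close> is at least 1, the factor with \<open>i = 1\<close>
        is \<open>rho (a n)\<close>, and shifting the index of the others gives
        \<open>Q n\<close>.\<close>
      have "R (n - 1) = (\<Prod>i\<in>{Suc 0..Suc (N - 1)}. rho (a (n - 1 + i)))"
        using N by (simp add: R_def)
      also have "\<dots> = rho (a n) * (\<Prod>i\<in>{Suc 1..Suc (N - 1)}. rho (a (n - 1 + i)))"
        using elim by (subst prod.atLeast_Suc_atMost) auto
      also have "(\<Prod>i\<in>{Suc 1..Suc (N - 1)}. rho (a (n - 1 + i))) = Q n"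
        unfolding prod.shift_bounds_cl_Suc_ivl using elim by (simp add: Q_def)
      finally show ?thesis .
    qed
    moreover have "complex_of_real (rho (a n) * rho (a n)) = 1 - a n * cnj (a n)"
    proof -
      have "rho (a n) * rho (a n) = 1 - (norm (a n))\<^sup>2"
        using norm_schur[OF elim] by (simp add: rho_def abs_square_le_1)
      then show ?thesis
        by (simp only: of_real_diff of_real_1 complex_norm_square)
    qed
    ultimately have "complex_of_real (rho (a n)) * complex_of_real (R (n - 1)) = (1 - a n * cnj (a n)) * Q n"
      by (simp only: of_real_mult mult.assoc[symmetric])
    then have e: "P * (complex_of_real (rho (a n)) * complex_of_real (R (n - 1)))
        = P * ((1 - a n * cnj (a n)) * Q n)"
      by (rule arg_cong)
    show ?case
      unfolding e by (simp add: algebra_simps)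
  qed
  ultimately show ?thesis
    unfolding Q_def by (rule Lim_transform_eventually)
qed

lemma schur_sum_tendsto_0:
  "(\<lambda>n. ((\<Sum>j=1..N. cnj (a (n + j - 1)) * a (n + j)) + S) *
            complex_of_real (\<Prod>i=1..N - 1. rho (a (n + i)))) \<longlonglongrightarrow> 0"
proof (rule tendsto_0_eventually_minus)
  show "(\<lambda>n. ip (lin_prod * \<phi> n) (\<phi> (n + (N - 1)))) \<longlonglongrightarrow> 0"
    by (rule ip_lin_prod_tendsto_0) (simp add: ip_phi_phi)
next
  fix n :: nat assume n: "n \<ge> 1"
  define m where "m = n + (N - 1)"
  have eq: "n + N = Suc m" "n + N - 1 = m" using N by (simp_all add: m_def)
  have m: "m \<ge> 1" using n by (simp add: m_def)
  note c = lin_prod_phi_coeffs(1,2)[OF n, unfolded eq(1)] lin_prod_phi_coeffs(3)[OF n, unfolded eq(2)]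
  \<comment> \<open>Both sides equal \<open>subleading (n + N)\<close>, reached in one step from
    \<open>m\<close> and in \<open>N\<close> steps from \<open>n\<close>.\<close>
  have sum: "subleading m + cnj (a m) * a (Suc m)
      = subleading n + (\<Sum>j=1..N. cnj (a (n + j - 1)) * a (n + j))"
    using subleading_Suc[of m] subleading_add[OF n, of N] n eq(1) by (simp add: m_def)
  have "ip (lin_prod * \<phi> n) (\<phi> m)
      = (kappa n * (subleading n - S) - kappa n * (cnj (a m) * a (Suc m) + subleading m)) / kappa m"
    unfolding ip_phi_Suc[OF c(1) m] c(2,3) ..
  also have "\<dots> = kappa n / kappa m * (subleading n - S - (subleading m + cnj (a m) * a (Suc m)))"
    by (simp add: field_simps)
  finally have ip: "ip (lin_prod * \<phi> n) (\<phi> m) = \<dots>" .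
  show "((\<Sum>j=1..N. cnj (a (n + j - 1)) * a (n + j)) + S) *
            complex_of_real (\<Prod>i=1..N - 1. rho (a (n + i))) = - ip (lin_prod * \<phi> n) (\<phi> (n + (N - 1)))"
    unfolding kappa_ratio[symmetric] m_def[symmetric] ip sum by (simp add: algebra_simps)
qed

lemma schur_sum_P_tendsto_0:
  assumes "N \<ge> 2"
  shows "(\<lambda>n. ((\<Sum>j=1..N - 1. cnj (a (n + j - 1)) * a (n + j))
              + P * a n * cnj (a (n + N - 1)) + S) *
            complex_of_real (\<Prod>i=1..N - 2. rho (a (n + i)))) \<longlonglongrightarrow> 0"
proof (rule tendsto_0_eventually_minus)
  show "(\<lambda>n. ip (lin_prod * \<phi> n) (pCons 0 (\<phi> (n + (N - 2))))) \<longlonglongrightarrow> 0"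
    by (rule ip_lin_prod_tendsto_0) (simp add: ip_pCons_pCons ip_phi_phi)
next
  fix n :: nat assume n: "n \<ge> 1"
  define m where "m = n + (N - 2)"
  have eq: "n + N = Suc (Suc m)" "n + N - 1 = Suc m" "n + (N - 1) = Suc m"
    using assms by (simp_all add: m_def)
  have m: "m \<ge> 1" using n by (simp add: m_def)
  note c = lin_prod_phi_coeffs(1,2)[OF n, unfolded eq(1)] lin_prod_phi_coeffs(3)[OF n, unfolded eq(2)]
    lin_prod_phi_coeffs(4)[OF n]
  \<comment> \<open>Here both sides equal \<open>subleading (n + N - 1)\<close>, so the sum has only
    \<open>N - 1\<close> terms.\<close>
  have sum: "subleading m + cnj (a m) * a (Suc m)
      = subleading n + (\<Sum>j=1..N - 1. cnj (a (n + j - 1)) * a (n + j))"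
    using subleading_Suc[OF m] subleading_add[OF n, of "N - 1"] unfolding eq by simp
  have "ip (lin_prod * \<phi> n) (pCons 0 (\<phi> m))
      = (kappa n * (subleading n - S) - kappa n * (cnj (a m) * a (Suc m) + subleading m)
         - P * a n * kappa n * cnj (a (Suc m))) / kappa m"
    unfolding ip_pCons_phi_Suc_Suc[OF c(1) m] c(2,3,4) ..
  also have "\<dots> = kappa n / kappa m *
      (subleading n - S - (subleading m + cnj (a m) * a (Suc m)) - P * a n * cnj (a (Suc m)))"
    by (simp add: field_simps)
  finally have ip: "ip (lin_prod * \<phi> n) (pCons 0 (\<phi> m)) = \<dots>" .
  show "((\<Sum>j=1..N - 1. cnj (a (n + j - 1)) * a (n + j))
              + P * a n * cnj (a (n + N - 1)) + S) *
            complex_of_real (\<Prod>i=1..N - 2. rho (a (n + i)))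
      = - ip (lin_prod * \<phi> n) (pCons 0 (\<phi> (n + (N - 2))))"
    unfolding kappa_ratio[symmetric] m_def[symmetric] ip sum eq(2) by (simp add: algebra_simps)
qed

end

end

theorem theorem4p3:
  fixes \<mu> :: "complex measure" and a w :: "nat \<Rightarrow> complex" and N :: nat and P S :: complex
  assumes "circle_prob \<mu>"
    and "infinite (msupp \<mu>)"
    and "\<And>n. n \<ge> 1 \<Longrightarrow> norm (a n) < 1"
    and "schur_parameters \<mu> a"
    and "N \<ge> 1"
    and "\<And>i. i \<in> {1..N} \<Longrightarrow> w i \<in> sphere 0 1"
    and "{z. z islimpt msupp \<mu>} \<subseteq> w ` {1..N}"
  defines "P \<equiv> (-1) ^ N * (\<Prod>i=1..N. w i)"
    and "S \<equiv> (\<Sum>i=1..N. w i)"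
  shows "(\<lambda>n. \<Prod>i=1..N. rho (a (n + i))) \<longlonglongrightarrow> 0 \<and>
    (N \<ge> 2 \<longrightarrow>
      (\<lambda>n. (cnj (a n) * a (n + N) - P) *
            complex_of_real (\<Prod>i=1..N - 1. rho (a (n + i)))) \<longlonglongrightarrow> 0 \<and>
      (\<lambda>n. ((\<Sum>j=1..N. cnj (a (n + j - 1)) * a (n + j)) + S) *
            complex_of_real (\<Prod>i=1..N - 1. rho (a (n + i)))) \<longlonglongrightarrow> 0 \<and>
      (\<lambda>n. ((\<Sum>j=1..N - 1. cnj (a (n + j - 1)) * a (n + j))
              + P * a n * cnj (a (n + N - 1)) + S) *
            complex_of_real (\<Prod>i=1..N - 2. rho (a (n + i)))) \<longlonglongrightarrow> 0)"
proof -
  obtain \<phi> where \<phi>: "orthonormal_polys \<mu> \<phi>"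
    and szego: "\<And>n. n \<ge> 1 \<Longrightarrow> smult (complex_of_real (rho (a n))) (\<phi> n)
      = pCons 0 (\<phi> (n - 1)) + smult (a n) (rev_poly (\<phi> (n - 1)))"
    using assms(4) unfolding schur_parameters_def by blast
  interpret prob_space \<mu>
    using assms(1) by (simp add: circle_prob_def)
  interpret schur_system \<mu> \<phi> a
    using assms(1,3) \<phi> szego by unfold_locales (auto simp: circle_prob_def)
  have derived: "\<And>z. z islimpt msupp \<mu> \<Longrightarrow> z \<in> w ` {1..N}"
    using assms(7) by blast
  show ?thesis
    unfolding P_def S_def
    using rho_prod_tendsto_0[OF \<open>N \<ge> 1\<close> derived] cnj_schur_minus_P_tendsto_0[OF \<open>N \<ge> 1\<close> derived]
      schur_sum_tendsto_0[OF \<open>N \<ge> 1\<close> derived] schur_sum_P_tendsto_0[OF \<open>N \<ge> 1\<close> derived]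
    by blast
qed

end
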